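(* Let $N\ge 4$ be an integer and let $\sigma_0,\sigma_1\in\mathbb{R}$. Consider the partially specified $N\times N$ symmetric circulant matrix $$\begin{bmatrix} \sigma_0 & \sigma_1 & ? & \cdots & ? & \sigma_1\\ \sigma_1 & \sigma_0 & \sigma_1 & ? & \cdots & ?\\ ? & \sigma_1 & \sigma_0 & \sigma_1 & \ddots & \vdots\\ \vdots & \ddots & \ddots & \ddots & \ddots & ?\\ ? & \cdots & ? & \sigma_1 & \sigma_0 & \sigma_1\\ \sigma_1 & ? & \cdots & ? & \sigma_1 & \sigma_0 \end{bmatrix},$$ in which the diagonal entries equal $\sigma_0$, the entries in positions $(i,j)$ with $i-j\equiv\pm1 \pmod N$ equal $\sigma_1$, and all other entries (marked $?$) are unspecified. This partially specified matrix admits a positive definite circulant completion if and only if $$|\sigma_1|<\sigma_0\quad\text{when } N \text{ is even},$$ and $$\cos\left(\frac{N-1}{N}\pi\right)\sigma_0<\sigma_1<\sigma_0\quad\text{when } N \text{ is odd}.$$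
   Context: A positive definite circulant completion is a real symmetric positive definite $N\times N$ matrix that is circulant (its $(i,j)$ entry depends only on $j-i \bmod N$) and that agrees with the partially specified matrix in all the specified positions. *)

theory Defs
  imports Complex_Main "HOL-Number_Theory.Cong" "Jordan_Normal_Form.Matrix"
begin

definition symmetric_mat :: "'a mat \<Rightarrow> bool" where
  "symmetric_mat A \<longleftrightarrow> transpose_mat A = A"

definition positive_definite_mat :: "real mat \<Rightarrow> bool" where
  "positive_definite_mat A \<longleftrightarrow> square_mat A \<and> symmetric_mat A \<and>
     (\<forall>v \<in> carrier_vec (dim_row A). v \<noteq> 0\<^sub>v (dim_row A) \<longrightarrow> 0 < v \<bullet> (A *\<^sub>v v))"

(* The difference j - i is taken over the integers, so that mod yields its least
   nonnegative residue also when j < i. *)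
definition circulant_mat :: "'a mat \<Rightarrow> bool" where
  "circulant_mat A \<longleftrightarrow> square_mat A \<and>
     (\<exists>c :: int \<Rightarrow> 'a. \<forall>i < dim_row A. \<forall>j < dim_col A.
        A $$ (i, j) = c ((int j - int i) mod int (dim_row A)))"

(* A partially specified matrix has entries Some x (specified as x) or None (unspecified). *)
type_synonym 'a partial_mat = "'a option mat"

definition completes :: "'a mat \<Rightarrow> 'a partial_mat \<Rightarrow> bool" where
  "completes A P \<longleftrightarrow> dim_row A = dim_row P \<and> dim_col A = dim_col P \<and>
     (\<forall>i < dim_row P. \<forall>j < dim_col P. \<forall>x. P $$ (i, j) = Some x \<longrightarrow> A $$ (i, j) = x)"

definition has_pd_circulant_completion :: "real partial_mat \<Rightarrow> bool" where
  "has_pd_circulant_completion P \<longleftrightarrow>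
     (\<exists>A. completes A P \<and> positive_definite_mat A \<and> circulant_mat A)"

(* Positions are numbered from 0; this affects neither i = j nor the congruences on i - j. *)
definition banded_circulant_partial_mat :: "nat \<Rightarrow> real \<Rightarrow> real \<Rightarrow> real partial_mat" where
  "banded_circulant_partial_mat N \<sigma>\<^sub>0 \<sigma>\<^sub>1 = mat N N (\<lambda>(i, j).
     if i = j then Some \<sigma>\<^sub>0
     else if [int i - int j = 1] (mod int N) \<or> [int i - int j = - 1] (mod int N) then Some \<sigma>\<^sub>1
     else None)"

end

theory Submission
  imports Defs
begin

text \<open>
  The discrete Fourier transform makes the statement a question about convex combinations. The
  values $\lambda_m = \sum_k c_k \cos(2\pi mk/N)$ of a symmetric circulant matrix with first row $c$ are
  its eigenvalues, and $\sigma_0$ and $\sigma_1$ are the means over $m$ of $\lambda_m$ and of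
  $\lambda_m \cos(2\pi m/N)$. If all $\lambda_m$ are positive, then $\sigma_1/\sigma_0$ is a convex
  combination of the numbers $\cos(2\pi m/N)$ with all weights positive, so it lies strictly between
  the smallest and the largest of them. The largest is $1$. The smallest belongs to a multiple
  of $2\pi/N$ nearest to $\pi$, for instance to $m = \lfloor N/2 \rfloor$; it is $-1$ for even $N$ and
  $\cos((N-1)\pi/N)$ for odd $N$. Both parities thus become the single condition
  $\ell\sigma_0 < \sigma_1 < \sigma_0$ with $\ell = \cos(2\pi\lfloor N/2\rfloor/N)$.

  Necessity is \<open>pd_completion_band_inequality\<close>, the averaging argument. It works with the sums
  $\sum_{i,j} a_{ij}\cos(2\pi m(j-i)/N)$, which are $N\lambda_m$ for a circulant matrix but are
  positive for every positive definite matrix; summed over $m$ with weights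
  $p + q\cos(2\pi m/N)$ they only involve the specified entries.

  Sufficiency is \<open>pd_circulant_completion_exists\<close>: a spectrum that is constant except at one
  extreme frequency $\pm\varphi$ already attains every admissible ratio. In terms of entries, the completion is
  a positive multiple of the identity plus a nonnegative multiple of a rank one or rank two
  matrix $[\cos(\varphi(j-i))]$ with $\varphi = 0$ or $\varphi = 2\pi\lfloor N/2\rfloor/N$.
\<close>

section \<open>Sums of cosines over the roots of unity\<close>

lemma sum_cos_multiples:
  assumes "N > 0"
  shows "(\<Sum>m<N. cos (2 * pi * real m * of_int k / real N)) = (if int N dvd k then real N else 0)"
proof -
  define z where "z = cis (2 * pi * of_int k / real N)"
  have pow: "z ^ m = cis (2 * pi * real m * of_int k / real N)" for m
    unfolding z_def DeMoivre by (simp add: field_simps)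
  have "(\<Sum>m<N. cos (2 * pi * real m * of_int k / real N)) = Re (\<Sum>m<N. z ^ m)"
    by (simp add: pow)
  also have "\<dots> = (if int N dvd k then real N else 0)"
  proof (cases "int N dvd k")
    case True
    then obtain l where l: "k = int N * l" by blast
    have "2 * pi * of_int k / real N = 2 * pi * of_int l"
      using assms by (simp add: l)
    then have "z = 1" by (simp only: z_def cis_multiple_2pi Ints_of_int)
    then show ?thesis using True by simp
  next
    case False
    have "z \<noteq> 1"
    proof
      assume "z = 1"
      then have "cos (2 * pi * of_int k / real N) = 1"
        by (metis Re_complex_of_real cis.sel(1) of_real_1 z_def)
      then obtain l :: int where "2 * pi * of_int k / real N = of_int l * 2 * pi"
        by (auto simp: cos_one_2pi_int)
      then have "of_int k = (of_int (l * int N) :: real)"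
        using assms by (simp add: field_simps)
      then have "k = l * int N" by (simp only: of_int_eq_iff)
      with False show False by simp
    qed
    moreover have "2 * pi * real N * of_int k / real N = 2 * pi * of_int k"
      using assms by simp
    then have "z ^ N = 1" by (simp only: pow cis_multiple_2pi Ints_of_int)
    ultimately have "(\<Sum>m<N. z ^ m) = 0"
      by (simp add: geometric_sum)
    then show ?thesis using False by simp
  qed
  finally show ?thesis .
qed

lemma sum_dvd_indicator:
  fixes x :: real
  assumes "N > 0"
  shows "(\<Sum>j<N. if int N dvd int j + t then x else 0) = x"
proof -
  define r where "r = nat ((- t) mod int N)"
  have r: "int r = (- t) mod int N" "r < N"
    using assms by (auto simp: r_def nat_less_iff)
  have "int N dvd int j + t \<longleftrightarrow> j = r" if "j < N" for j
  proof -
    have "int N dvd int j + t \<longleftrightarrow> int j mod int N = (- t) mod int N"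
      by (simp add: mod_eq_dvd_iff)
    also have "\<dots> \<longleftrightarrow> j = r" using that r(1)[symmetric] by simp
    finally show ?thesis .
  qed
  then have "(\<Sum>j<N. if int N dvd int j + t then x else 0) = (\<Sum>j<N. if j = r then x else 0)"
    by (intro sum.cong) auto
  then show ?thesis using r by simp
qed

text \<open>
  For odd $N$ every $N$-th root of unity is at angular distance at least $\pi/N$ from $-1$,
  because $|N - 2m| \ge 1$. For even $N$ the left-hand side is $-1$.
\<close>

lemma min_cos_multiples:
  assumes "m < N"
  shows "cos (2 * pi * real (N div 2) / real N) \<le> cos (2 * pi * real m / real N)"
proof (cases "even N")
  case True
  then have "2 * pi * real (N div 2) / real N = pi"
    using assms by (simp add: real_of_nat_div)
  then show ?thesis by simp
next
  case False
  have N: "real N > 0" using assms by simp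
  have refl: "cos (2 * pi * real k / real N) = - cos (pi * \<bar>real N - 2 * real k\<bar> / real N)" for k
  proof -
    have "cos (pi * \<bar>real N - 2 * real k\<bar> / real N) = cos \<bar>pi * (real N - 2 * real k) / real N\<bar>"
      using N by (simp only: abs_mult abs_divide abs_of_pos[OF N] abs_of_pos[OF pi_gt_zero])
    also have "\<dots> = cos (pi * (real N - 2 * real k) / real N)"
      by (rule cos_abs_real)
    also have "pi * (real N - 2 * real k) / real N = pi - 2 * pi * real k / real N"
      using N by (simp add: field_simps)
    finally show ?thesis by simp
  qed
  have near: "\<bar>real N - 2 * real (N div 2)\<bar> = 1"
    using False by (auto elim!: oddE)
  have "int N - 2 * int m \<noteq> 0"
    using False by presburger
  then have "\<bar>int N - 2 * int m\<bar> \<ge> 1" by linarith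
  then have "real_of_int 1 \<le> of_int \<bar>int N - 2 * int m\<bar>" by (simp only: of_int_le_iff)
  then have lower: "1 \<le> \<bar>real N - 2 * real m\<bar>" by simp
  have upper: "\<bar>real N - 2 * real m\<bar> \<le> real N"
    using assms by linarith
  have "cos (pi * \<bar>real N - 2 * real m\<bar> / real N) \<le> cos (pi * 1 / real N)"
    using lower upper N by (intro cos_monotone_0_pi_le) (auto simp: field_simps)
  then show ?thesis
    unfolding refl near by simp
qed

section \<open>Necessity: averaging the Fourier sums\<close>

lemma quadratic_form_eq_double_sum:
  fixes A :: "'a :: comm_semiring_0 mat"
  assumes "A \<in> carrier_mat N N" "v \<in> carrier_vec N"
  shows "v \<bullet> (A *\<^sub>v v) = (\<Sum>i<N. \<Sum>j<N. A $$ (i, j) * (v $ i * v $ j))"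
proof -
  have "v \<bullet> (A *\<^sub>v v) = (\<Sum>i<N. v $ i * (\<Sum>j<N. A $$ (i, j) * v $ j))"
    using assms by (auto simp: scalar_prod_def atLeast0LessThan intro!: sum.cong)
  then show ?thesis
    by (simp add: sum_distrib_left ac_simps)
qed

text \<open>
  The sum is the Hermitian form of $A$ at the vector $(e^{i\theta k})_k$; its real and imaginary
  parts are real test vectors, and the real part is nonzero since it starts with $1$.
\<close>

lemma pd_fourier_sum_pos:
  assumes A: "A \<in> carrier_mat N N" "positive_definite_mat A" and "N > 0"
  shows "0 < (\<Sum>i<N. \<Sum>j<N. A $$ (i, j) * cos (\<theta> * (real j - real i)))"
proof -
  define u where "u = vec N (\<lambda>k. cos (\<theta> * real k))"
  define w where "w = vec N (\<lambda>k. sin (\<theta> * real k))"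
  have uw: "u \<in> carrier_vec N" "w \<in> carrier_vec N" by (simp_all add: u_def w_def)
  have pos: "0 < v \<bullet> (A *\<^sub>v v)" if "v \<in> carrier_vec N" "v \<noteq> 0\<^sub>v N" for v
    using A that by (auto simp: positive_definite_mat_def)
  have "u $ 0 \<noteq> 0\<^sub>v N $ 0" using \<open>N > 0\<close> by (simp add: u_def)
  then have "0 < u \<bullet> (A *\<^sub>v u)" using pos uw by metis
  moreover have "0 \<le> w \<bullet> (A *\<^sub>v w)"
  proof (cases "w = 0\<^sub>v N")
    case True
    then show ?thesis using A by simp
  next
    case False
    then show ?thesis using pos uw by (simp add: less_imp_le)
  qed
  ultimately have "0 < u \<bullet> (A *\<^sub>v u) + w \<bullet> (A *\<^sub>v w)" by linarith
  also have "\<dots> = (\<Sum>i<N. \<Sum>j<N. A $$ (i, j) * cos (\<theta> * (real j - real i)))"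
    unfolding quadratic_form_eq_double_sum[OF A(1) uw(1)] quadratic_form_eq_double_sum[OF A(1) uw(2)]
      sum.distrib[symmetric]
    by (intro sum.cong refl) (simp add: u_def w_def right_diff_distrib cos_diff algebra_simps)
  finally show ?thesis .
qed

lemma completes_banded_entries:
  assumes "completes A (banded_circulant_partial_mat N \<sigma>\<^sub>0 \<sigma>\<^sub>1)" "N \<ge> 2" "i < N" "j < N"
  shows "int N dvd int j - int i \<Longrightarrow> A $$ (i, j) = \<sigma>\<^sub>0"
    and "int N dvd int j - int i + 1 \<Longrightarrow> A $$ (i, j) = \<sigma>\<^sub>1"
    and "int N dvd int j - int i - 1 \<Longrightarrow> A $$ (i, j) = \<sigma>\<^sub>1"
proof -
  let ?P = "banded_circulant_partial_mat N \<sigma>\<^sub>0 \<sigma>\<^sub>1"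
  have entry: "?P $$ (i, j) = Some x \<Longrightarrow> A $$ (i, j) = x" for x
    using assms by (auto simp: completes_def banded_circulant_partial_mat_def)
  have P: "?P $$ (i, j) = (if i = j then Some \<sigma>\<^sub>0
     else if [int i - int j = 1] (mod int N) \<or> [int i - int j = - 1] (mod int N) then Some \<sigma>\<^sub>1
     else None)"
    using assms by (simp add: banded_circulant_partial_mat_def)
  show "A $$ (i, j) = \<sigma>\<^sub>0" if "int N dvd int j - int i"
  proof -
    have "int j mod int N = int i mod int N" using that by (simp add: mod_eq_dvd_iff)
    then have "i = j" using assms by simp
    then show ?thesis using entry P by simp
  qed
  show "A $$ (i, j) = \<sigma>\<^sub>1" if d: "int N dvd int j - int i + 1"
  proof -
    have "int N dvd - (int j - int i + 1)" using d by (simp only: dvd_minus_iff)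
    then have "[int i - int j = 1] (mod int N)" by (simp add: cong_iff_dvd_diff algebra_simps)
    moreover have "i \<noteq> j" using d assms by auto
    ultimately show ?thesis using entry P by simp
  qed
  show "A $$ (i, j) = \<sigma>\<^sub>1" if d: "int N dvd int j - int i - 1"
  proof -
    have "int N dvd - (int j - int i - 1)" using d by (simp only: dvd_minus_iff)
    then have "[int i - int j = - 1] (mod int N)" by (simp add: cong_iff_dvd_diff algebra_simps)
    moreover have "i \<noteq> j" using d assms by auto
    ultimately show ?thesis using entry P by simp
  qed
qed

text \<open>
  The weights $p + q\cos(2\pi m/N)$ are the eigenvalues of a positive semidefinite circulant
  matrix, namely $pI + \frac{q}{2}(C + C^T)$ for the cyclic shift $C$; the claim says that the trace
  of its product with $A$ is positive. That matrix vanishes at the unspecified positions, so the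
  trace is determined by $\sigma_0$ and $\sigma_1$.
\<close>

lemma pd_completion_band_inequality:
  assumes compl: "completes A (banded_circulant_partial_mat N \<sigma>\<^sub>0 \<sigma>\<^sub>1)"
    and pd: "positive_definite_mat A" and N: "N \<ge> 2"
    and nonneg: "\<And>m. m < N \<Longrightarrow> 0 \<le> p + q * cos (2 * pi * real m / real N)"
    and strict: "m\<^sub>0 < N" "0 < p + q * cos (2 * pi * real m\<^sub>0 / real N)"
  shows "0 < p * \<sigma>\<^sub>0 + q * \<sigma>\<^sub>1"
proof -
  have A: "A \<in> carrier_mat N N"
    using compl by (auto simp: completes_def banded_circulant_partial_mat_def)
  have N0: "N > 0" using N by simp
  define F where "F m k = cos (2 * pi * real m * of_int k / real N)" for m and k :: int
  define wt where "wt m = p + q * cos (2 * pi * real m / real N)" for m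
  define S where "S m = (\<Sum>i<N. \<Sum>j<N. A $$ (i, j) * F m (int j - int i))" for m
  have S_pos: "0 < S m" for m
    using pd_fourier_sum_pos[OF A pd N0, of "2 * pi * real m / real N"]
    by (simp add: S_def F_def)
  have sum_F: "(\<Sum>m<N. F m k) = (if int N dvd k then real N else 0)" for k
    unfolding F_def using sum_cos_multiples[OF N0] .
  have prod: "wt m * F m k = p * F m k + q / 2 * (F m (k + 1) + F m (k - 1))" for m k
  proof -
    let ?a = "2 * pi * real m / real N"
    have F: "F m k = cos (?a * of_int k)" for k by (simp add: F_def)
    have "F m (k + 1) + F m (k - 1) = 2 * cos ?a * F m k"
      unfolding F of_int_add of_int_diff of_int_1 distrib_left right_diff_distrib
      by (simp add: cos_add cos_diff)
    then show ?thesis by (simp add: wt_def algebra_simps)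
  qed
  have entry: "A $$ (i, j) * (\<Sum>m<N. wt m * F m (int j - int i)) =
      (if int N dvd int j + (- int i) then real N * (p * \<sigma>\<^sub>0) else 0)
    + ((if int N dvd int j + (1 - int i) then real N * (q / 2 * \<sigma>\<^sub>1) else 0)
    + (if int N dvd int j + (- 1 - int i) then real N * (q / 2 * \<sigma>\<^sub>1) else 0))"
    if ij: "i < N" "j < N" for i j
  proof -
    note e = completes_banded_entries[OF compl N ij]
    have shift: "int j + (- int i) = int j - int i" "int j + (1 - int i) = int j - int i + 1"
      "int j + (- 1 - int i) = int j - int i - 1" by simp_all
    have "(\<Sum>m<N. wt m * F m (int j - int i)) = p * (\<Sum>m<N. F m (int j - int i))
        + q / 2 * ((\<Sum>m<N. F m (int j - int i + 1)) + (\<Sum>m<N. F m (int j - int i - 1)))"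
      unfolding prod sum.distrib[symmetric] sum_distrib_left ..
    then show ?thesis
      unfolding sum_F shift using e by (auto simp: algebra_simps)
  qed
  have "0 < (\<Sum>m<N. wt m * S m)"
  proof (rule sum_pos2[of _ m\<^sub>0])
    show "0 < wt m\<^sub>0 * S m\<^sub>0" using strict S_pos by (simp add: wt_def)
    show "0 \<le> wt m * S m" if "m \<in> {..<N}" for m
      using nonneg that less_imp_le[OF S_pos] by (simp add: wt_def)
  qed (use strict in auto)
  also have "(\<Sum>m<N. wt m * S m)
      = (\<Sum>m<N. \<Sum>i<N. \<Sum>j<N. A $$ (i, j) * (wt m * F m (int j - int i)))"
    unfolding S_def sum_distrib_left by (simp only: mult.left_commute)
  also have "\<dots> = (\<Sum>i<N. \<Sum>m<N. \<Sum>j<N. A $$ (i, j) * (wt m * F m (int j - int i)))"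
    by (rule sum.swap)
  also have "\<dots> = (\<Sum>i<N. \<Sum>j<N. A $$ (i, j) * (\<Sum>m<N. wt m * F m (int j - int i)))"
    unfolding sum_distrib_left by (rule sum.cong[OF refl]) (rule sum.swap)
  also have "\<dots> = (\<Sum>i<N. real N * (p * \<sigma>\<^sub>0) + (real N * (q / 2 * \<sigma>\<^sub>1) + real N * (q / 2 * \<sigma>\<^sub>1)))"
  proof (rule sum.cong[OF refl])
    fix i assume "i \<in> {..<N}"
    then have "(\<Sum>j<N. A $$ (i, j) * (\<Sum>m<N. wt m * F m (int j - int i))) =
      (\<Sum>j<N. (if int N dvd int j + (- int i) then real N * (p * \<sigma>\<^sub>0) else 0)
        + ((if int N dvd int j + (1 - int i) then real N * (q / 2 * \<sigma>\<^sub>1) else 0)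
        + (if int N dvd int j + (- 1 - int i) then real N * (q / 2 * \<sigma>\<^sub>1) else 0)))"
      by (intro sum.cong refl entry) auto
    then show "(\<Sum>j<N. A $$ (i, j) * (\<Sum>m<N. wt m * F m (int j - int i))) =
      real N * (p * \<sigma>\<^sub>0) + (real N * (q / 2 * \<sigma>\<^sub>1) + real N * (q / 2 * \<sigma>\<^sub>1))"
      unfolding sum.distrib sum_dvd_indicator[OF N0] .
  qed
  also have "\<dots> = real N * real N * (p * \<sigma>\<^sub>0 + q * \<sigma>\<^sub>1)"
    by (simp add: algebra_simps)
  finally show ?thesis
    using N0 by (simp add: zero_less_mult_iff)
qed

section \<open>Sufficiency: a spectrum with one exceptional frequency\<close>

text \<open>
  The addition theorem for the cosine turns the quadratic form of the second summand into
  $\gamma$ times a sum of two squares.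
\<close>

lemma positive_definite_scalar_plus_cos:
  assumes "\<alpha> > 0" "\<gamma> \<ge> 0"
  shows "positive_definite_mat
    (mat N N (\<lambda>(i, j). (if i = j then \<alpha> else 0) + \<gamma> * cos (\<phi> * (real j - real i))))"
    (is "positive_definite_mat ?A")
proof -
  have "0 < v \<bullet> (?A *\<^sub>v v)" if v: "v \<in> carrier_vec N" "v \<noteq> 0\<^sub>v N" for v
  proof -
    let ?c = "\<Sum>i<N. v $ i * cos (\<phi> * real i)" and ?s = "\<Sum>i<N. v $ i * sin (\<phi> * real i)"
    have "v \<bullet> (?A *\<^sub>v v) = (\<Sum>i<N. \<Sum>j<N. ?A $$ (i, j) * (v $ i * v $ j))"
      using v by (intro quadratic_form_eq_double_sum) auto
    also have "\<dots> = (\<Sum>i<N. \<Sum>j<N. (if i = j then \<alpha> * (v $ i)\<^sup>2 else 0)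
        + \<gamma> * ((v $ i * cos (\<phi> * real i)) * (v $ j * cos (\<phi> * real j))
             + (v $ i * sin (\<phi> * real i)) * (v $ j * sin (\<phi> * real j))))"
      by (intro sum.cong refl)
        (auto simp: right_diff_distrib cos_diff algebra_simps power2_eq_square)
    also have "\<dots> = \<alpha> * (\<Sum>i<N. (v $ i)\<^sup>2) + \<gamma> * (?c * ?c + ?s * ?s)"
      by (simp add: sum.distrib sum_distrib_left[symmetric] sum_product)
    finally have eq: "v \<bullet> (?A *\<^sub>v v) = \<alpha> * (\<Sum>i<N. (v $ i)\<^sup>2) + \<gamma> * (?c * ?c + ?s * ?s)" .
    obtain k where "k < N" "v $ k \<noteq> 0"
      using v by (metis carrier_vecD dim_vec eq_vecI index_zero_vec(1) index_zero_vec(2))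
    then have "0 < (\<Sum>i<N. (v $ i)\<^sup>2)"
      by (intro sum_pos2[of _ k]) auto
    then show ?thesis
      unfolding eq using assms by (intro add_pos_nonneg mult_pos_pos mult_nonneg_nonneg) auto
  qed
  moreover have "cos (\<phi> * (real j - real i)) = cos (\<phi> * (real i - real j))" for i j
    using cos_minus[of "\<phi> * (real i - real j)"] by (simp add: algebra_simps)
  then have "symmetric_mat ?A"
    by (auto simp: symmetric_mat_def intro!: eq_matI)
  ultimately show ?thesis
    by (simp add: positive_definite_mat_def)
qed

lemma cos_periodic_mod:
  assumes "N > 0" and \<phi>: "\<phi> * real N = 2 * pi * of_int n"
    and d: "int N dvd k - l"
  shows "cos (\<phi> * of_int k) = cos (\<phi> * of_int l)"
proof -
  obtain t where "k - l = int N * t" using d by blast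
  then have "k = l + int N * t" by simp
  then have "\<phi> * of_int k = \<phi> * of_int l + \<phi> * real N * of_int t"
    by (simp add: algebra_simps)
  also have "\<dots> = \<phi> * of_int l + 2 * pi * of_int (n * t)"
    by (simp add: \<phi>)
  finally show ?thesis
    by (simp only: cos_add sin_int_2pin cos_int_2pin mult_1_right mult_zero_right diff_zero)
qed

lemma scalar_plus_cos_completes:
  assumes "N > 0" "\<phi> * real N = 2 * pi * of_int n" "\<alpha> > 0" "\<gamma> \<ge> 0"
  shows "has_pd_circulant_completion
    (banded_circulant_partial_mat N (\<alpha> + \<gamma>) (\<gamma> * cos \<phi>))"
proof -
  define A where
    "A = mat N N (\<lambda>(i, j). (if i = j then \<alpha> else 0) + \<gamma> * cos (\<phi> * (real j - real i)))"
  have cong: "cos (\<phi> * of_int k) = cos (\<phi> * of_int l)" if "int N dvd k - l" for k l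
    using cos_periodic_mod[OF assms(1,2) that] .
  have "completes A (banded_circulant_partial_mat N (\<alpha> + \<gamma>) (\<gamma> * cos \<phi>))"
  proof -
    have "cos (\<phi> * (real j - real i)) = cos \<phi>"
      if "[int i - int j = 1] (mod int N) \<or> [int i - int j = - 1] (mod int N)" for i j
    proof -
      have "cos (\<phi> * of_int (int i - int j)) = cos \<phi>"
        using that cong[of "int i - int j" 1] cong[of "int i - int j" "- 1"]
        by (auto simp: cong_iff_dvd_diff)
      then show ?thesis
        using cos_minus[of "\<phi> * (real i - real j)"] by (simp add: algebra_simps)
    qed
    then show ?thesis
      by (auto simp: completes_def A_def banded_circulant_partial_mat_def split: if_splits)
  qed
  moreover have "positive_definite_mat A"
    unfolding A_def by (rule positive_definite_scalar_plus_cos) fact+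
  moreover have "circulant_mat A"
  proof -
    define c where "c k = (if k = 0 then \<alpha> else 0) + \<gamma> * cos (\<phi> * of_int k)" for k :: int
    have "A $$ (i, j) = c ((int j - int i) mod int N)" if "i < N" "j < N" for i j
    proof -
      have "(int j - int i) mod int N = 0 \<longleftrightarrow> int j mod int N = int i mod int N"
        by (simp add: mod_eq_dvd_iff dvd_eq_mod_eq_0)
      then have "(int j - int i) mod int N = 0 \<longleftrightarrow> i = j"
        using that by auto
      moreover have "cos (\<phi> * of_int (int j - int i)) = cos (\<phi> * of_int ((int j - int i) mod int N))"
        by (rule cong) (metis mod_eq_dvd_iff mod_mod_trivial)
      ultimately show ?thesis using that by (simp add: A_def c_def)
    qed
    then show ?thesis by (auto simp: circulant_mat_def A_def)
  qed
  ultimately show ?thesis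
    unfolding has_pd_circulant_completion_def by blast
qed

text \<open>
  The sign of $\sigma_1$ decides which extreme frequency carries the exceptional eigenvalue:
  $\varphi = 0$ raises $\sigma_1$ above $0$, and $\varphi$ with $\cos\varphi < 0$ lowers it.
\<close>

lemma pd_circulant_completion_exists:
  assumes "N > 0" "\<phi> * real N = 2 * pi * of_int n" "cos \<phi> < 0"
    and lower: "cos \<phi> * \<sigma>\<^sub>0 < \<sigma>\<^sub>1" and upper: "\<sigma>\<^sub>1 < \<sigma>\<^sub>0"
  shows "has_pd_circulant_completion (banded_circulant_partial_mat N \<sigma>\<^sub>0 \<sigma>\<^sub>1)"
proof (cases "\<sigma>\<^sub>1 \<ge> 0")
  case True
  then show ?thesis
    using scalar_plus_cos_completes[of N 0 0 "\<sigma>\<^sub>0 - \<sigma>\<^sub>1" \<sigma>\<^sub>1] assms(1) upper by simp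
next
  case False
  define \<gamma> where "\<gamma> = \<sigma>\<^sub>1 / cos \<phi>"
  have "\<gamma> \<ge> 0" using False assms(3) by (simp add: \<gamma>_def divide_nonpos_neg)
  moreover have "\<sigma>\<^sub>0 - \<gamma> > 0" using lower assms(3) by (simp add: \<gamma>_def field_simps)
  moreover have "\<gamma> * cos \<phi> = \<sigma>\<^sub>1" using assms(3) by (simp add: \<gamma>_def)
  ultimately show ?thesis
    using scalar_plus_cos_completes[OF assms(1,2), of "\<sigma>\<^sub>0 - \<gamma>" \<gamma>] by simp
qed

section \<open>The characterization\<close>

theorem proposition3p1:
  fixes N :: nat and \<sigma>\<^sub>0 \<sigma>\<^sub>1 :: real
  assumes "N \<ge> 4"
  shows "has_pd_circulant_completion (banded_circulant_partial_mat N \<sigma>\<^sub>0 \<sigma>\<^sub>1) \<longleftrightarrow>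
    (if even N then \<bar>\<sigma>\<^sub>1\<bar> < \<sigma>\<^sub>0
     else cos ((real N - 1) / real N * pi) * \<sigma>\<^sub>0 < \<sigma>\<^sub>1 \<and> \<sigma>\<^sub>1 < \<sigma>\<^sub>0)"
proof -
  define \<phi> where "\<phi> = 2 * pi * real (N div 2) / real N"
  have N: "N > 0" "N \<ge> 2" using assms by auto
  have period: "\<phi> * real N = 2 * pi * of_int (int (N div 2))"
    using N by (simp add: \<phi>_def)
  have even_\<phi>: "cos \<phi> = - 1" if "even N"
  proof -
    have "\<phi> = pi" using that N by (simp add: \<phi>_def real_of_nat_div)
    then show ?thesis by simp
  qed
  have odd_\<phi>: "\<phi> = (real N - 1) / real N * pi" if "odd N"
    using that by (auto simp: \<phi>_def field_simps elim!: oddE)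
  have cos_neg: "cos \<phi> < 0"
  proof -
    have "4 * real (N div 2) > real N" "2 * real (N div 2) \<le> real N"
      using assms by linarith+
    then have "pi / 2 < \<phi>" "\<phi> \<le> pi"
      using N by (simp_all add: \<phi>_def field_simps)
    then show ?thesis
      using cos_monotone_0_pi[of "pi / 2" \<phi>] by simp
  qed
  have "has_pd_circulant_completion (banded_circulant_partial_mat N \<sigma>\<^sub>0 \<sigma>\<^sub>1) \<longleftrightarrow>
      cos \<phi> * \<sigma>\<^sub>0 < \<sigma>\<^sub>1 \<and> \<sigma>\<^sub>1 < \<sigma>\<^sub>0" (is "?compl \<longleftrightarrow> ?bounds")
  proof
    assume ?compl
    then obtain A where A: "completes A (banded_circulant_partial_mat N \<sigma>\<^sub>0 \<sigma>\<^sub>1)"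
      "positive_definite_mat A"
      by (auto simp: has_pd_circulant_completion_def)
    have "0 < (- cos \<phi>) * \<sigma>\<^sub>0 + 1 * \<sigma>\<^sub>1"
    proof (rule pd_completion_band_inequality[OF A N(2), of _ _ 0])
      show "0 \<le> - cos \<phi> + 1 * cos (2 * pi * real m / real N)" if "m < N" for m
        using min_cos_multiples[OF that] by (simp add: \<phi>_def)
    qed (use N cos_neg in auto)
    moreover have "0 < 1 * \<sigma>\<^sub>0 + (- 1) * \<sigma>\<^sub>1"
      \<comment> \<open>Any frequency with cosine below 1 serves for strictness, in particular \<open>\<phi>\<close> itself.\<close>
      by (rule pd_completion_band_inequality[OF A N(2), of _ _ "N div 2"])
        (use N cos_neg in \<open>auto simp: \<phi>_def\<close>)
    ultimately show ?bounds by simp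
  next
    assume ?bounds
    then show ?compl
      using pd_circulant_completion_exists[OF N(1) period cos_neg] by blast
  qed
  then show ?thesis
    using even_\<phi> odd_\<phi> by (auto simp: abs_less_iff)
qed

end
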